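(* For all integers $n,k,i,j\ge 0$ let $\overline{C}_2(n;k;i,j)$ denote the number of jagged overpartitions of $n$ (as defined in the context) with exactly $k$ non-overlined parts, exactly $i$ parts of color $a$ and exactly $j$ parts of color $b$, satisfying the additional condition that the final $\ell$ parts are overlined, where $\ell$ is the number of parts of color $b$ or $u$. Then, as formal power series, $$\sum_{n,k,i,j \geq 0} \overline{C}_2(n;k;i,j) a^ib^jd^kq^n = (-q;q)_{\infty}(-bq^2;q^2)_{\infty} \sum_{r \geq 0} \frac{q^{\binom{r+1}{2}}(ad)^r(-q/d;q)_r}{(q^2;q^2)_r}.$$
   Context: Notation: $(x;q)_n=\prod_{m=0}^{n-1}(1-xq^m)$ for $n\in\mathbb{N}\cup\{\infty\}$. A jagged overpartition of $n$ is a finite sequence $(\lambda_1,\dots,\lambda_s)$ of non-negative integers with sum $n$, where each part carries one of three colors $a$, $b$, $u$, the final occurrence of a positive part may be overlined (zero parts are never overlined), the last part satisfies $\lambda_s\notin\{0_a,0_b,\overline{1}_a,\overline{1}_b\}$, and for each $i$ the difference $\lambda_i-\lambda_{i+1}$ is at least the entry of the following matrix in the row given by the type of $\lambda_i$ and the column given by the type of $\lambda_{i+1}$ (types: $\overline{a},\overline{b},\overline{u}$ for overlined parts of colors $a,b,u$; $a,b,u$ for non-overlined ones), columns in the order $\overline{a},\overline{b},\overline{u},a,b,u$: row $\overline{a}$: $2,0,2,2,0,2$; row $\overline{b}$: $2,2,3,2,2,3$; row $\overline{u}$: $1,0,1,1,0,1$; row $a$: $1,-1,1,1,-1,1$; row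 $b$: $1,1,2,1,1,2$; row $u$: $0,-1,0,0,-1,0$. Non-overlined parts include parts equal to $0$. *)

theory Defs
  imports "HOL-Analysis.Analysis" "HOL-Computational_Algebra.Computational_Algebra"
begin

section \<open>Jagged overpartitions\<close>

datatype color = A | B | U

datatype part = Part (val: nat) (col: color) (overlined: bool)

fun type_index :: "part \<Rightarrow> nat" where
  "type_index (Part v A ov) = (if ov then 0 else 3)"
| "type_index (Part v B ov) = (if ov then 1 else 4)"
| "type_index (Part v U ov) = (if ov then 2 else 5)"

text \<open>Rows and columns are indexed by the types
  overlined \<open>a, b, u\<close>, then non-overlined \<open>a, b, u\<close>.\<close>

definition diff_matrix :: "int list list" where
  "diff_matrix =
    [[2,  0, 2, 2,  0, 2],
     [2,  2, 3, 2,  2, 3],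
     [1,  0, 1, 1,  0, 1],
     [1, -1, 1, 1, -1, 1],
     [1,  1, 2, 1,  1, 2],
     [0, -1, 0, 0, -1, 0]]"

definition min_diff :: "part \<Rightarrow> part \<Rightarrow> int" where
  "min_diff x y = diff_matrix ! type_index x ! type_index y"

text \<open>Occurrences of a part are occurrences of the coloured integer, so \<open>k\<close> in
  colour \<open>a\<close> and \<open>k\<close> in colour \<open>b\<close> are different parts, each of which may be overlined at its
  own final occurrence. The empty sequence is a jagged overpartition of \<open>0\<close>.\<close>

definition jagged_overpartition :: "part list \<Rightarrow> bool" where
  "jagged_overpartition xs \<longleftrightarrow>
     (\<forall>x\<in>set xs. overlined x \<longrightarrow> val x > 0) \<and>
     (\<forall>s t. s < t \<and> t < length xs \<and> overlined (xs ! s) \<longrightarrow>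
        \<not> (val (xs ! t) = val (xs ! s) \<and> col (xs ! t) = col (xs ! s))) \<and>
     (xs \<noteq> [] \<longrightarrow> last xs \<notin> {Part 0 A False, Part 0 B False, Part 1 A True, Part 1 B True}) \<and>
     (\<forall>s. Suc s < length xs \<longrightarrow>
        int (val (xs ! s)) - int (val (xs ! Suc s)) \<ge> min_diff (xs ! s) (xs ! Suc s))"

definition final_parts_overlined :: "part list \<Rightarrow> bool" where
  "final_parts_overlined xs \<longleftrightarrow>
     (let l = length (filter (\<lambda>x. col x = B \<or> col x = U) xs)
      in \<forall>x\<in>set (drop (length xs - l) xs). overlined x)"

definition C2_set :: "nat \<Rightarrow> nat \<Rightarrow> nat \<Rightarrow> nat \<Rightarrow> part list set" where
  "C2_set n k i j = {xs. jagged_overpartition xs \<and> final_parts_overlined xs \<and>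
     sum_list (map val xs) = n \<and>
     length (filter (\<lambda>x. \<not> overlined x) xs) = k \<and>
     length (filter (\<lambda>x. col x = A) xs) = i \<and>
     length (filter (\<lambda>x. col x = B) xs) = j}"

definition C2 :: "nat \<Rightarrow> nat \<Rightarrow> nat \<Rightarrow> nat \<Rightarrow> nat" where
  "C2 n k i j = card (C2_set n k i j)"

lemma finite_C2_set: "finite (C2_set n k i j)"
proof -
  have len: "length xs \<le> sum_list (map val xs) + length (filter (\<lambda>x. \<not> overlined x) xs)"
    if "\<forall>x\<in>set xs. overlined x \<longrightarrow> val x > 0" for xs
    using that by (induction xs) auto
  have col_UNIV: "(UNIV :: color set) = {A, B, U}"
    using color.exhaust by auto
  define P where "P = (\<lambda>(v, c, ov). Part v c ov) ` ({..n} \<times> (UNIV :: color set) \<times> (UNIV :: bool set))"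
  have fin: "finite P"
    unfolding P_def col_UNIV by simp
  have "C2_set n k i j \<subseteq> {xs. set xs \<subseteq> P \<and> length xs \<le> n + k}"
  proof
    fix xs assume xs: "xs \<in> C2_set n k i j"
    hence "length xs \<le> n + k"
      using len[of xs] by (auto simp: C2_set_def jagged_overpartition_def)
    moreover have "x \<in> P" if "x \<in> set xs" for x
    proof -
      have "val x \<le> sum_list (map val xs)"
        using that by (intro member_le_sum_list) auto
      hence "(val x, col x, overlined x) \<in> {..n} \<times> UNIV \<times> UNIV"
        using xs by (auto simp: C2_set_def)
      thus ?thesis
        unfolding P_def by (rule rev_image_eqI) simp
    qed
    ultimately show "xs \<in> {xs. set xs \<subseteq> P \<and> length xs \<le> n + k}" by auto
  qed
  thus ?thesis
    using finite_lists_length_le[OF fin] finite_subset by blast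
qed

section \<open>q-Pochhammer symbols\<close>

definition qpoch :: "'a::comm_ring_1 \<Rightarrow> 'a \<Rightarrow> nat \<Rightarrow> 'a" where
  "qpoch x q n = (\<Prod>m<n. 1 - x * q ^ m)"

definition qpoch_inf :: "'a::{comm_ring_1, t2_space} \<Rightarrow> 'a \<Rightarrow> 'a" where
  "qpoch_inf x q = (\<Prod>m. 1 - x * q ^ m)"

section \<open>The ring of formal series\<close>

text \<open>Power series in \<open>q\<close> over the field of iterated Laurent series in the
  indeterminates \<open>a\<close>, \<open>b\<close>, \<open>d\<close>. It contains the ring of formal power series in
  \<open>a, b, d, q\<close>, and \<open>d\<close> is invertible in it. Limits of sums and products are \<open>q\<close>-adic:
  the metric on \<^typ>\<open>'a fps\<close> gives the coefficients the discrete topology.\<close>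

type_synonym coeff_field = "rat fls fls fls"
type_synonym series = "coeff_field fps"

definition var_a :: series where "var_a = fps_const (fls_const (fls_const fls_X))"
definition var_b :: series where "var_b = fps_const (fls_const fls_X)"
definition var_d :: series where "var_d = fps_const fls_X"
definition var_q :: series where "var_q = fps_X"

end

(* Give a part of value v the level v - 1 if it has colour b, and v otherwise. The difference
   conditions then say that consecutive levels drop by at least step c c' plus 1 if the larger
   part is overlined, where step is 0 or 1, and the condition on the last part says the same for a
   virtual part 0_a at the end. Hence a jagged overpartition is a word in a, b, u, a choice of
   overlines and arbitrary slacks, and the part in position p contributes p times its total drop
   to the sum. For m parts of colour a, j of colour b and h of colour u the overlines are free in
   the first m positions and forced afterwards, so overlines and slacks contribute a product. The
   sum over words is q^((t^2 + m + j)/2) [m+j, j]_{q^2} [m+j+h, h]_q with t = m - j, proved together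
   with its companions for the other two following letters. Euler's identity sums over h to
   (-q;q)_inf / (-q;q)_{m+j}, after which the sums over m and j separate. *)
theory Submission
  imports Defs
begin

unbundle no vec_syntax
unbundle fps_syntax

section \<open>Locally finite sums of formal power series\<close>

lemma has_sum_fps_superset:
  fixes f :: "'i \<Rightarrow> 'a :: ab_group_add fps"
  assumes "(f has_sum S) I" "finite Z" "Z \<subseteq> I" "\<And>x. x \<in> I \<Longrightarrow> x \<notin> Z \<Longrightarrow> f x $ n = 0"
  shows "S $ n = (\<Sum>x\<in>Z. f x $ n)"
  unfolding has_sum_fpsD(2)[OF assms(1), of n]
  by (rule sum.mono_neutral_left) (use assms in auto)

text \<open>Coefficients carry the discrete topology, so convergence means finite support in every
  coefficient. Any finite superset of the support serves equally well.\<close>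

lemma has_sum_fps_supersetI:
  fixes f :: "'i \<Rightarrow> 'a :: ab_group_add fps"
  assumes "\<And>n. \<exists>Z. finite Z \<and> Z \<subseteq> I \<and> (\<forall>x\<in>I - Z. f x $ n = 0) \<and> S $ n = (\<Sum>x\<in>Z. f x $ n)"
  shows "(f has_sum S) I"
proof (rule has_sum_fpsI)
  fix n
  obtain Z where Z: "finite Z" "Z \<subseteq> I" "\<forall>x\<in>I - Z. f x $ n = 0" "S $ n = (\<Sum>x\<in>Z. f x $ n)"
    using assms by blast
  have sub: "{x \<in> I. f x $ n \<noteq> 0} \<subseteq> Z"
    using Z by blast
  then show "finite {x \<in> I. f x $ n \<noteq> 0}"
    using Z(1) finite_subset by blast
  show "S $ n = (\<Sum>x | x \<in> I \<and> f x $ n \<noteq> 0. f x $ n)"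
    unfolding Z(4) by (rule sum.mono_neutral_right) (use Z sub in auto)
qed

lemma summable_on_fps:
  fixes f :: "'i \<Rightarrow> 'a :: ab_group_add fps"
  assumes "\<And>n. finite {x \<in> I. f x $ n \<noteq> 0}"
  shows "f summable_on I"
  unfolding summable_on_def
  by (rule exI[of _ "Abs_fps (\<lambda>n. \<Sum>x | x \<in> I \<and> f x $ n \<noteq> 0. f x $ n)"], rule has_sum_fpsI)
     (use assms in auto)

text \<open>For a fixed coefficient only finitely many terms survive, so this is the regrouping of a
  finite sum. All later changes of the summation order rest on it.\<close>

lemma has_sum_fps_fibres:
  fixes f :: "'i \<Rightarrow> 'a :: ab_group_add fps"
  assumes f: "(f has_sum S) I" and "\<pi> ` I \<subseteq> K"
    and g: "\<And>i. i \<in> K \<Longrightarrow> (f has_sum g i) {x \<in> I. \<pi> x = i}"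
  shows "(g has_sum S) K"
proof (rule has_sum_fps_supersetI)
  fix n
  define Z where "Z = {x \<in> I. f x $ n \<noteq> 0}"
  have Z: "finite Z" "Z \<subseteq> I"
    using has_sum_fpsD(1)[OF f, of n] by (auto simp: Z_def)
  have gi: "g i $ n = (\<Sum>x | x \<in> Z \<and> \<pi> x = i. f x $ n)" if "i \<in> K" for i
  proof (rule has_sum_fps_superset[OF g[OF that]])
    show "finite {x \<in> Z. \<pi> x = i}"
      using Z by simp
  qed (auto simp: Z_def)
  have "S $ n = (\<Sum>x\<in>Z. f x $ n)"
    by (rule has_sum_fps_superset[OF f]) (use Z in \<open>auto simp: Z_def\<close>)
  also have "\<dots> = (\<Sum>i\<in>\<pi> ` Z. \<Sum>x | x \<in> Z \<and> \<pi> x = i. f x $ n)"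
    by (rule sum.image_gen) (fact Z)
  also have "\<dots> = (\<Sum>i\<in>\<pi> ` Z. g i $ n)"
  proof (rule sum.cong)
    fix i assume "i \<in> \<pi> ` Z"
    then have "i \<in> K"
      using Z assms(2) by auto
    then show "(\<Sum>x | x \<in> Z \<and> \<pi> x = i. f x $ n) = g i $ n"
      by (simp add: gi)
  qed simp
  finally have "S $ n = (\<Sum>i\<in>\<pi> ` Z. g i $ n)" .
  moreover have "g i $ n = 0" if "i \<in> K - \<pi> ` Z" for i
    using gi[of i] that by (metis (mono_tags, lifting) DiffE empty_Collect_eq image_eqI sum.empty)
  ultimately show "\<exists>Z. finite Z \<and> Z \<subseteq> K \<and> (\<forall>x\<in>K - Z. g x $ n = 0) \<and> S $ n = (\<Sum>i\<in>Z. g i $ n)"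
    using Z assms(2) by (intro exI[of _ "\<pi> ` Z"]) auto
qed

lemma has_sum_fps_times:
  fixes f :: "'i \<Rightarrow> 'a :: comm_ring_1 fps"
  assumes f: "(f has_sum S) I" and g: "(g has_sum T) J"
  shows "((\<lambda>(x, y). f x * g y) has_sum S * T) (I \<times> J)"
proof (rule has_sum_fps_supersetI)
  fix n
  \<comment> \<open>Coefficient n of a product involves all lower coefficients of the factors, so
    \<open>X\<close> and \<open>Y\<close> collect every index that matters up to n.\<close>
  define X where "X = (\<Union>k\<le>n. {x \<in> I. f x $ k \<noteq> 0})"
  define Y where "Y = (\<Union>k\<le>n. {x \<in> J. g x $ k \<noteq> 0})"
  have XY: "finite X" "finite Y" "X \<subseteq> I" "Y \<subseteq> J"
    using has_sum_fpsD(1)[OF f] has_sum_fpsD(1)[OF g] by (auto simp: X_def Y_def)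
  have X: "S $ k = (\<Sum>x\<in>X. f x $ k)" if "k \<le> n" for k
    by (rule has_sum_fps_superset[OF f]) (use XY that in \<open>auto simp: X_def\<close>)
  have Y: "T $ k = (\<Sum>x\<in>Y. g x $ k)" if "k \<le> n" for k
    by (rule has_sum_fps_superset[OF g]) (use XY that in \<open>auto simp: Y_def\<close>)
  have "(S * T) $ n = (\<Sum>k=0..n. (\<Sum>x\<in>X. f x $ k) * (\<Sum>y\<in>Y. g y $ (n - k)))"
    unfolding fps_mult_nth by (rule sum.cong) (auto simp: X Y)
  also have "\<dots> = (\<Sum>k=0..n. \<Sum>p\<in>X \<times> Y. f (fst p) $ k * g (snd p) $ (n - k))"
    by (simp add: sum_product sum.cartesian_product case_prod_unfold)
  also have "\<dots> = (\<Sum>p\<in>X \<times> Y. (f (fst p) * g (snd p)) $ n)"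
    unfolding fps_mult_nth by (rule sum.swap)
  finally have "(S * T) $ n = (\<Sum>p\<in>X \<times> Y. (case p of (x, y) \<Rightarrow> f x * g y) $ n)"
    by (simp add: case_prod_unfold)
  moreover have "(f x * g y) $ n = 0" if "x \<in> I" "y \<in> J" "x \<notin> X \<or> y \<notin> Y" for x y
    unfolding fps_mult_nth
  proof (rule sum.neutral, rule ballI)
    fix k assume "k \<in> {0..n}"
    then show "f x $ k * g y $ (n - k) = 0"
      using that by (auto simp: X_def Y_def)
  qed
  ultimately show "\<exists>Z. finite Z \<and> Z \<subseteq> I \<times> J \<and> (\<forall>x\<in>I \<times> J - Z. (case x of (x, y) \<Rightarrow> f x * g y) $ n = 0)
      \<and> (S * T) $ n = (\<Sum>x\<in>Z. (case x of (x, y) \<Rightarrow> f x * g y) $ n)"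
    using XY by (intro exI[of _ "X \<times> Y"]) auto
qed

lemma has_sum_fps_cmult:
  fixes f :: "'i \<Rightarrow> 'a :: comm_ring_1 fps"
  assumes "(f has_sum S) I"
  shows "((\<lambda>x. c * f x) has_sum c * S) I"
proof -
  have 1: "((\<lambda>_. c) has_sum c) {()}"
    using has_sum_finite[of "{()}" "\<lambda>_. c"] by simp
  have "{()} \<times> I = Pair () ` I"
    by auto
  then have "((\<lambda>(_, x). c * f x) has_sum c * S) (Pair () ` I)"
    using has_sum_fps_times[OF 1 assms] by simp
  then show ?thesis
    by (subst (asm) has_sum_reindex) (auto simp: inj_on_def o_def)
qed

lemma has_sum_fps_diff:
  fixes f :: "'i \<Rightarrow> 'a :: ab_group_add fps"
  assumes f: "(f has_sum S) I" and g: "(g has_sum T) I"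
  shows "((\<lambda>x. f x - g x) has_sum S - T) I"
proof (rule has_sum_fps_supersetI)
  fix n
  define Z where "Z = {x \<in> I. f x $ n \<noteq> 0} \<union> {x \<in> I. g x $ n \<noteq> 0}"
  have Z: "finite Z" "Z \<subseteq> I"
    using has_sum_fpsD(1)[OF f] has_sum_fpsD(1)[OF g] by (auto simp: Z_def)
  have "S $ n = (\<Sum>x\<in>Z. f x $ n)" "T $ n = (\<Sum>x\<in>Z. g x $ n)"
    by (rule has_sum_fps_superset[OF f] has_sum_fps_superset[OF g]; use Z in \<open>auto simp: Z_def\<close>)+
  then show "\<exists>Z. finite Z \<and> Z \<subseteq> I \<and> (\<forall>x\<in>I - Z. (f x - g x) $ n = 0) \<and>
      (S - T) $ n = (\<Sum>x\<in>Z. (f x - g x) $ n)"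
    using Z by (intro exI[of _ Z]) (auto simp: Z_def sum_subtractf)
qed

lemma has_sum_fps_unique:
  fixes f :: "'i \<Rightarrow> 'a :: ab_group_add fps"
  assumes "(f has_sum S) I" "(f has_sum T) I"
  shows "S = T"
  using assms by (intro fps_ext) (simp add: has_sum_fpsD(2))

lemma suminf_fps_eqI:
  fixes f :: "nat \<Rightarrow> 'a :: ab_group_add fps"
  assumes "(f has_sum S) UNIV"
  shows "(\<Sum>n. f n) = S"
  using has_sum_imp_sums[OF assms] sums_unique by blast

section \<open>Euler's identity\<close>

text \<open>The terms in Euler's expansion of the infinite product (-zQ; Q)_inf.\<close>

definition euler_term :: "'a::field fps \<Rightarrow> 'a fps \<Rightarrow> nat \<Rightarrow> 'a fps" where
  "euler_term Q z r = Q ^ (Suc r choose 2) * z ^ r * inverse (qpoch Q Q r)"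

definition euler_sum :: "'a::field fps \<Rightarrow> 'a fps \<Rightarrow> 'a fps" where
  "euler_sum Q z = infsum (euler_term Q z) UNIV"

lemma fps_power_mult_nth_eq_0:
  fixes Q :: "'a :: comm_ring_1 fps"
  assumes "Q $ 0 = 0" "n < N"
  shows "(Q ^ N * f) $ n = 0"
  unfolding fps_mult_nth
  by (rule sum.neutral) (use startsby_zero_power_prefix[OF assms(1), of N] assms(2) in auto)

lemma qpoch_0 [simp]: "qpoch x q 0 = 1"
  by (simp add: qpoch_def)

lemma qpoch_Suc: "qpoch x q (Suc n) = qpoch x q n * (1 - x * q ^ n)"
  by (simp add: qpoch_def)

lemma qpoch_fps_nth_0:
  fixes x :: "'a::idom fps"
  assumes "x $ 0 = 0"
  shows "qpoch x q n $ 0 = 1"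
  using assms by (induction n) (auto simp: qpoch_Suc)

lemma Suc_choose_two_ge: "r \<le> Suc r choose 2"
  by (simp add: numeral_2_eq_2)

context
  fixes Q :: "'a::field fps"
  assumes Q0: "Q $ 0 = 0"
begin

lemma euler_term_nth_eq_0:
  assumes "n < r"
  shows "euler_term Q z r $ n = 0"
proof -
  have "n < Suc r choose 2"
    using Suc_choose_two_ge[of r] assms by linarith
  then show ?thesis
    unfolding euler_term_def mult.assoc using Q0 by (intro fps_power_mult_nth_eq_0)
qed

lemma has_sum_euler: "(euler_term Q z has_sum euler_sum Q z) UNIV"
proof -
  have "euler_term Q z summable_on UNIV"
  proof (rule summable_on_fps)
    fix n
    have "{r \<in> UNIV. euler_term Q z r $ n \<noteq> 0} \<subseteq> {..n}"
      using euler_term_nth_eq_0 by (force simp: not_le[symmetric])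
    then show "finite {r \<in> UNIV. euler_term Q z r $ n \<noteq> 0}"
      using finite_subset by blast
  qed
  then show ?thesis
    unfolding euler_sum_def by (rule has_sum_infsum)
qed

text \<open>Term r for z minus term r for zQ carries the factor 1 - Q^r, which cancels the last
  factor of (Q; Q)_r and leaves zQ times term r - 1 for zQ.\<close>

lemma euler_sum_step: "euler_sum Q z = (1 + z * Q) * euler_sum Q (z * Q)"
proof -
  let ?g = "\<lambda>r. euler_term Q z r - euler_term Q (z * Q) r"
  have step: "?g (Suc r) = z * Q * euler_term Q (z * Q) r" for r
  proof -
    define P where "P = inverse (qpoch Q Q r)"
    have nz: "(1 - Q ^ Suc r) $ 0 \<noteq> 0"
      using Q0 by (simp add: fps_power_zeroth)
    have P: "inverse (qpoch Q Q (Suc r)) * (1 - Q ^ Suc r) = P"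
      using inverse_mult_eq_1[OF nz] by (simp add: P_def qpoch_Suc fps_inverse_mult ac_simps)
    have "?g (Suc r) = Q ^ (Suc (Suc r) choose 2) * z ^ Suc r *
        (inverse (qpoch Q Q (Suc r)) * (1 - Q ^ Suc r))"
      by (simp add: euler_term_def power_mult_distrib algebra_simps)
    also have "Suc (Suc r) choose 2 = (Suc r choose 2) + Suc r"
      by (simp add: numeral_2_eq_2)
    finally show ?thesis
      unfolding P by (simp add: euler_term_def P_def power_add power_mult_distrib ac_simps)
  qed
  have "(?g has_sum (euler_sum Q z - euler_sum Q (z * Q))) UNIV"
    by (intro has_sum_fps_diff has_sum_euler)
  also have "?this \<longleftrightarrow> (?g has_sum (euler_sum Q z - euler_sum Q (z * Q))) (range Suc)"
  proof (rule has_sum_cong_neutral)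
    fix r assume "r \<in> UNIV - range Suc"
    then show "?g r = 0"
      by (cases r) (auto simp: euler_term_def)
  qed auto
  also have "\<dots> \<longleftrightarrow> ((\<lambda>r. z * Q * euler_term Q (z * Q) r) has_sum
      (euler_sum Q z - euler_sum Q (z * Q))) UNIV"
    by (subst has_sum_reindex) (auto simp: o_def step)
  finally have "euler_sum Q z - euler_sum Q (z * Q) = z * Q * euler_sum Q (z * Q)"
    using has_sum_fps_cmult[OF has_sum_euler] by (rule has_sum_fps_unique)
  then show ?thesis
    by (simp add: algebra_simps)
qed

lemma euler_sum_finite_prod:
  "euler_sum Q z = (\<Prod>m<n. 1 + z * Q ^ Suc m) * euler_sum Q (z * Q ^ n)"
proof (induction n)
  case (Suc n)
  show ?case
    by (subst Suc.IH, subst euler_sum_step) (simp add: algebra_simps)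
qed simp

text \<open>Every term with r > 0 contains Q^(n r), so only r = 0 reaches the coefficients below n.
  This makes the finite products converge.\<close>

lemma euler_sum_nth_small:
  assumes "k < n"
  shows "euler_sum Q (z * Q ^ n) $ k = (1 :: 'a fps) $ k"
proof -
  have "euler_term Q (z * Q ^ n) r $ k = 0" if "r \<noteq> 0" for r
  proof -
    have "euler_term Q (z * Q ^ n) r =
        Q ^ (n * r) * (Q ^ (Suc r choose 2) * z ^ r * inverse (qpoch Q Q r))"
      by (simp add: euler_term_def power_mult_distrib power_mult ac_simps)
    moreover have "k < n * r"
      using assms that by (metis One_nat_def Suc_leI less_le_trans mult.right_neutral mult_le_mono2 neq0_conv)
    ultimately show ?thesis
      using fps_power_mult_nth_eq_0[OF Q0] by metis
  qed
  then have "euler_sum Q (z * Q ^ n) $ k = (\<Sum>r\<in>{0}. euler_term Q (z * Q ^ n) r $ k)"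
    by (intro has_sum_fps_superset[OF has_sum_euler]) auto
  then show ?thesis
    by (simp add: euler_term_def numeral_2_eq_2)
qed

lemma euler_sum_eq_qpoch_inf: "euler_sum Q z = qpoch_inf (- z * Q) Q"
proof -
  let ?f = "\<lambda>m. 1 - (- z * Q) * Q ^ m"
  have "(\<lambda>n. \<Prod>m<n. ?f m) \<longlonglongrightarrow> euler_sum Q z"
  proof (rule tendsto_fpsI)
    fix k
    show "\<forall>\<^sub>F n in sequentially. (\<Prod>m<n. ?f m) $ k = euler_sum Q z $ k"
      using eventually_gt_at_top[of k]
    proof eventually_elim
      case (elim n)
      have "euler_sum Q z $ k = ((\<Prod>m<n. ?f m) * euler_sum Q (z * Q ^ n)) $ k"
        by (subst euler_sum_finite_prod[of _ n]) (simp add: mult.assoc)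
      also have "\<dots> = ((\<Prod>m<n. ?f m) * 1) $ k"
        unfolding fps_mult_nth using elim by (intro sum.cong) (auto simp: euler_sum_nth_small)
      finally show ?case by simp
    qed
  qed
  \<comment> \<open>\<open>has_prod\<close> is defined by products over \<open>{..n}\<close> and
    demands a nonzero limit, hence the shift here and the constant term computed next.\<close>
  then have "(\<lambda>n. \<Prod>m\<le>n. ?f m) \<longlonglongrightarrow> euler_sum Q z"
    unfolding lessThan_Suc_atMost[symmetric] by (rule LIMSEQ_Suc)
  moreover have "euler_sum Q z $ 0 = 1"
    using euler_sum_finite_prod[of z 1] euler_sum_nth_small[of 0 1 z] Q0 by simp
  then have "euler_sum Q z \<noteq> 0"
    by auto
  ultimately have "?f has_prod euler_sum Q z"
    by (simp add: has_prod_def raw_has_prod_def)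
  then show ?thesis
    unfolding qpoch_inf_def by (rule has_prod_unique)
qed

end

section \<open>Coloured words\<close>

text \<open>The least drop in level between non-overlined parts of the given colours.\<close>

fun step :: "color \<Rightarrow> color \<Rightarrow> nat" where
  "step A x = (if x = B then 0 else 1)"
| "step B x = (if x = A then 0 else 1)"
| "step U x = 0"

text \<open>Words, and below also lists of overlines, slacks and parts, are stored with the last part at
  the head, so that the position of the head is the length of the list. The argument \<open>x\<close> is the
  colour of the part following the head.\<close>

fun word_weight :: "color list \<Rightarrow> color \<Rightarrow> nat" where
  "word_weight [] x = 0"
| "word_weight (c # w) x = Suc (length w) * step c x + (if c = B then 1 else 0) + word_weight w c"

definition words :: "nat \<Rightarrow> nat \<Rightarrow> nat \<Rightarrow> color list set" where
  "words m j h = {w. count_list w A = m \<and> count_list w B = j \<and> count_list w U = h}"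

definition word_sum :: "color \<Rightarrow> nat \<Rightarrow> nat \<Rightarrow> nat \<Rightarrow> 'a::field fps" where
  "word_sum x m j h = (\<Sum>w\<in>words m j h. fps_X ^ word_weight w x)"

lemma UNIV_color: "(UNIV :: color set) = {A, B, U}"
  using color.exhaust by auto

lemma length_eq_count_list_color: "length w = count_list w A + count_list w B + count_list w U"
proof (induction w)
  case (Cons c w)
  then show ?case by (cases c) auto
qed simp

lemma length_words: "w \<in> words m j h \<Longrightarrow> length w = m + j + h"
  by (simp add: words_def length_eq_count_list_color)

lemma finite_words: "finite (words m j h)"
proof (rule finite_subset)
  show "words m j h \<subseteq> {w. set w \<subseteq> UNIV \<and> length w = m + j + h}"
    using length_words by auto
  show "finite {w. set w \<subseteq> (UNIV :: color set) \<and> length w = m + j + h}"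
    by (rule finite_lists_length_eq) (simp add: UNIV_color)
qed

lemma words_0: "words 0 0 0 = {[]}"
proof -
  have "w = []" if "w \<in> words 0 0 0" for w
    using length_words[OF that] by simp
  then show ?thesis
    by (auto simp: words_def)
qed

lemma words_rec:
  assumes "m + j + h > 0"
  shows "words m j h =
    (if m = 0 then {} else (#) A ` words (m - 1) j h) \<union>
    ((if j = 0 then {} else (#) B ` words m (j - 1) h) \<union>
     (if h = 0 then {} else (#) U ` words m j (h - 1)))" (is "_ = ?R")
proof (rule set_eqI)
  fix w
  show "w \<in> words m j h \<longleftrightarrow> w \<in> ?R"
  proof (cases w)
    case Nil
    then show ?thesis
      using assms by (auto simp: words_def)
  next
    case (Cons c v)
    then show ?thesis
      by (cases c) (auto simp: words_def image_iff)
  qed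
qed

lemma word_sum_0: "word_sum x 0 0 0 = 1"
  by (simp add: word_sum_def words_0)

text \<open>The head sits at position s, so it costs s times its step to x, plus one for b, and it
  becomes the following letter of the rest. The letter u has step 0.\<close>

lemma word_sum_rec:
  assumes "m + j + h > 0"
  defines "s \<equiv> m + j + h"
  shows "(word_sum x m j h :: 'a::field fps) =
    (if m = 0 then 0 else fps_X ^ (s * step A x) * word_sum A (m - 1) j h) +
    (if j = 0 then 0 else fps_X ^ (s * step B x) * (fps_X * word_sum B m (j - 1) h)) +
    (if h = 0 then 0 else word_sum U m j (h - 1))"
proof -
  let ?g = "\<lambda>w. fps_X ^ word_weight w x :: 'a fps"
  let ?SA = "if m = 0 then {} else (#) A ` words (m - 1) j h"
  let ?SB = "if j = 0 then {} else (#) B ` words m (j - 1) h"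
  let ?SU = "if h = 0 then {} else (#) U ` words m j (h - 1)"
  have "word_sum x m j h = sum ?g (?SA \<union> (?SB \<union> ?SU))"
    unfolding word_sum_def words_rec[OF assms(1)] ..
  also have "\<dots> = sum ?g ?SA + sum ?g (?SB \<union> ?SU)"
    by (rule sum.union_disjoint) (auto simp: finite_words)
  also have "sum ?g (?SB \<union> ?SU) = sum ?g ?SB + sum ?g ?SU"
    by (rule sum.union_disjoint) (auto simp: finite_words)
  also have "sum ?g ?SA = (if m = 0 then 0 else fps_X ^ (s * step A x) * word_sum A (m - 1) j h)"
    by (auto simp: word_sum_def sum.reindex sum_distrib_left s_def length_words power_add
             simp del: step.simps intro!: sum.cong)
  also have "sum ?g ?SB = (if j = 0 then 0 else fps_X ^ (s * step B x) * (fps_X * word_sum B m (j - 1) h))"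
    by (auto simp: word_sum_def sum.reindex sum_distrib_left s_def length_words power_add
             simp del: step.simps intro!: sum.cong)
  also have "sum ?g ?SU = (if h = 0 then 0 else word_sum U m j (h - 1))"
    by (auto simp: word_sum_def sum.reindex intro!: sum.cong)
  finally show ?thesis
    by (simp only: add.assoc)
qed

section \<open>Exponents of the closed form\<close>

text \<open>For \<open>t = m - j\<close> these are \<open>j + t (t + 1) / 2\<close> and \<open>j + t (t - 1) / 2\<close>.\<close>

definition expo_A :: "nat \<Rightarrow> nat \<Rightarrow> nat" where
  "expo_A m j = nat (((int m - int j)\<^sup>2 + int m + int j) div 2)"

definition expo_B :: "nat \<Rightarrow> nat \<Rightarrow> nat" where
  "expo_B m j = nat (((int m - int j)\<^sup>2 - int m + 3 * int j) div 2)"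

lemma double_expo_A: "2 * int (expo_A m j) = (int m - int j)\<^sup>2 + int m + int j"
proof -
  have "even ((int m - int j)\<^sup>2 + int m + int j)"
    by (cases "even m"; cases "even j") simp_all
  moreover have "(int m - int j)\<^sup>2 + int m + int j \<ge> 0"
    by simp
  ultimately show ?thesis
    by (simp add: expo_A_def)
qed

lemma double_expo_B: "2 * int (expo_B m j) = (int m - int j)\<^sup>2 - int m + 3 * int j"
proof -
  have "even ((int m - int j)\<^sup>2 - int m + 3 * int j)"
    by (cases "even m"; cases "even j") simp_all
  moreover have "(int m - int j)\<^sup>2 - int m + 3 * int j \<ge> 0"
  proof -
    \<comment> \<open>With t = m - j the numerator is t^2 - t + 2j, so t \<le> t^2 is
      enough.\<close>
    have "int m - int j \<le> (int m - int j)\<^sup>2"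
    proof (cases "int m - int j \<le> 0")
      case True
      then show ?thesis
        using zero_le_power2 order_trans by blast
    next
      case False
      then show ?thesis
        by (intro self_le_power) auto
    qed
    then show ?thesis by simp
  qed
  ultimately show ?thesis
    by (simp add: expo_B_def)
qed

text \<open>This and \<open>expo_B_rec\<close> match the steps of size 0: a b before an a costs only
  its extra one, and an a before a b costs nothing.\<close>

lemma expo_A_rec: "0 < j \<Longrightarrow> expo_A m j = Suc (expo_B m (j - 1))"
  using double_expo_A[of m j] double_expo_B[of m "j - 1"]
  by (cases j) (simp_all add: power2_eq_square algebra_simps)

lemma expo_B_rec: "0 < m \<Longrightarrow> expo_B m j = expo_A (m - 1) j"
  using double_expo_A[of "m - 1" j] double_expo_B[of m j]
  by (cases m) (simp_all add: power2_eq_square algebra_simps)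

text \<open>The exponents differ by m - j. In additive form, this and \<open>expo_B_A\<close> turn
  the powers 2j and 2m from \<open>word_factor_B\<close> and \<open>word_factor_A\<close> into m +
  j.\<close>

lemma expo_A_B: "2 * j + expo_A m j = m + j + expo_B m j"
  using double_expo_A[of m j] double_expo_B[of m j] by linarith

lemma expo_B_A: "2 * m + expo_B m j = m + j + expo_A m j"
  using double_expo_A[of m j] double_expo_B[of m j] by linarith

section \<open>Removing one letter from the product factor\<close>

text \<open>The product of the \<open>q\<^sup>2\<close>-binomial coefficient of \<open>m + j\<close> over \<open>j\<close> and the
  \<open>q\<close>-binomial coefficient of \<open>m + j + h\<close> over \<open>h\<close>.\<close>

definition word_factor :: "nat \<Rightarrow> nat \<Rightarrow> nat \<Rightarrow> 'a::field fps" where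
  "word_factor m j h = qpoch fps_X fps_X (m + j + h) * qpoch (- fps_X) fps_X (m + j) *
     inverse (qpoch (fps_X\<^sup>2) (fps_X\<^sup>2) m) * inverse (qpoch (fps_X\<^sup>2) (fps_X\<^sup>2) j) *
     inverse (qpoch fps_X fps_X h)"

lemma inverse_qpoch_Suc:
  fixes q :: "'a::field fps"
  assumes "q $ 0 = 0"
  shows "inverse (qpoch q q n) = (1 - q ^ Suc n) * inverse (qpoch q q (Suc n))"
proof -
  have "(1 - q ^ Suc n) $ 0 \<noteq> 0"
    using assms by (simp add: fps_power_zeroth)
  from inverse_mult_eq_1[OF this] show ?thesis
    by (simp add: qpoch_Suc fps_inverse_mult ac_simps)
qed

text \<open>Removing an a drops the last factors of (q; q)_(m+j+h), (-q; q)_(m+j) and (q^2; q^2)_m;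
  cross-multiplying avoids division.\<close>

lemma word_factor_A:
  assumes "0 < m"
  shows "(1 - fps_X ^ (m + j + h)) * (1 + fps_X ^ (m + j)) * (word_factor (m - 1) j h :: 'a::field fps) =
    (1 - fps_X ^ (2 * m)) * word_factor m j h"
proof -
  obtain k where k: "m = Suc k"
    using assms by (cases m) auto
  have i: "inverse (qpoch (fps_X\<^sup>2) (fps_X\<^sup>2) k :: 'a fps) =
      (1 - fps_X ^ (2 * m)) * inverse (qpoch (fps_X\<^sup>2) (fps_X\<^sup>2) m)"
    unfolding k power_mult by (rule inverse_qpoch_Suc) (simp add: fps_power_zeroth)
  show ?thesis
    by (simp add: word_factor_def k i[unfolded k] qpoch_Suc ac_simps)
qed

text \<open>\<open>word_factor\<close> is symmetric in m and j.\<close>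

lemma word_factor_B:
  assumes "0 < j"
  shows "(1 - fps_X ^ (m + j + h)) * (1 + fps_X ^ (m + j)) * (word_factor m (j - 1) h :: 'a::field fps) =
    (1 - fps_X ^ (2 * j)) * word_factor m j h"
  using word_factor_A[OF assms, of m h, where 'a = 'a] by (simp add: word_factor_def ac_simps)

lemma word_factor_U:
  assumes "0 < h"
  shows "(1 - fps_X ^ (m + j + h)) * (word_factor m j (h - 1) :: 'a::field fps) =
    (1 - fps_X ^ h) * word_factor m j h"
proof -
  obtain k where k: "h = Suc k"
    using assms by (cases h) auto
  have "inverse (qpoch fps_X fps_X (h - 1) :: 'a fps) = (1 - fps_X ^ h) * inverse (qpoch fps_X fps_X h)"
    unfolding k diff_Suc_1 by (rule inverse_qpoch_Suc) simp
  moreover have "qpoch fps_X fps_X (m + j + h) =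
      (1 - fps_X ^ (m + j + h)) * (qpoch fps_X fps_X (m + j + (h - 1)) :: 'a fps)"
    by (simp add: k qpoch_Suc)
  ultimately show ?thesis
    unfolding word_factor_def by (simp only: ac_simps)
qed

section \<open>Closed form of the word sums\<close>

text \<open>The sum for a following \<open>u\<close> has no product form, but it differs from the one for a following
  \<open>a\<close> only in the words ending in \<open>b\<close>; this closes the recursion.\<close>

lemma word_sum_closed:
  fixes m j h :: nat
  defines "s \<equiv> m + j + h"
  shows "(word_sum A m j h :: 'a::field_char_0 fps) = fps_X ^ expo_A m j * word_factor m j h"
    and "(word_sum B m j h :: 'a::field_char_0 fps) = fps_X ^ expo_B m j * word_factor m j h"
    and "(word_sum U m j h :: 'a::field_char_0 fps) = word_sum A m j h -
      (if j = 0 then 0 else (1 - fps_X ^ s) * (fps_X * word_sum B m (j - 1) h))"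
  unfolding s_def
proof (induction "m + j + h" arbitrary: m j h rule: less_induct)
  case less
  note IH = less.hyps
  define q where "q = (fps_X :: 'a fps)"
  define K where "K = (word_factor m j h :: 'a fps)"
  define s where "s = m + j + h"
  show "(word_sum A m j h :: 'a::field_char_0 fps) = fps_X ^ expo_A m j * word_factor m j h"
    and "(word_sum B m j h :: 'a::field_char_0 fps) = fps_X ^ expo_B m j * word_factor m j h"
    and "(word_sum U m j h :: 'a::field_char_0 fps) = word_sum A m j h -
      (if j = 0 then 0 else (1 - fps_X ^ (m + j + h)) * (fps_X * word_sum B m (j - 1) h))"
  proof (atomize (full), cases "s = 0")
    case True
    then show "(word_sum A m j h :: 'a::field_char_0 fps) = fps_X ^ expo_A m j * word_factor m j h \<and>
      (word_sum B m j h :: 'a::field_char_0 fps) = fps_X ^ expo_B m j * word_factor m j h \<and>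
      (word_sum U m j h :: 'a::field_char_0 fps) = word_sum A m j h -
      (if j = 0 then 0 else (1 - fps_X ^ (m + j + h)) * (fps_X * word_sum B m (j - 1) h))"
      by (simp add: s_def word_sum_0 expo_A_def expo_B_def word_factor_def)
  next
    case False
    \<comment> \<open>\<open>P\<close> and \<open>R\<close> are the values claimed for a following a
      and a following b; multiples of the three summands of the recursion are expressed through
      them.\<close>
    define P where "P = q ^ expo_A m j * K"
    define R where "R = q ^ expo_B m j * K"
    define Q where "Q = q ^ s"
    define N where "N = q ^ (m + j)"
    define H where "H = q ^ h"
    \<comment> \<open>The multiplier produced by removing an a or a b. It is nonzero for s > 0, so
      it cancels at the end.\<close>
    define D where "D = (1 - Q) * (1 + N)"
    define a' where "a' = (if m = 0 then 0 else word_sum A (m - 1) j h :: 'a fps)"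
    define b' where "b' = (if j = 0 then 0 else fps_X * word_sum B m (j - 1) h :: 'a fps)"
    define u' where "u' = (if h = 0 then 0 else word_sum U m j (h - 1) :: 'a fps)"
    have Q: "Q = N * H"
      by (simp add: Q_def N_def H_def s_def power_add)
    have PR: "q ^ (2 * j) * P = N * R" "q ^ (2 * m) * R = N * P"
      using arg_cong[OF expo_A_B[of j m], of "\<lambda>k. q ^ k * K"]
        arg_cong[OF expo_B_A[of m j], of "\<lambda>k. q ^ k * K"]
      by (simp_all only: P_def R_def N_def mult.assoc power_add)
    have a': "D * a' = R - N * P"
    \<comment> \<open>For m = 0 the left side is 0, and so is the right side because
      \<open>PR\<close> then gives R = N * P.\<close>
    proof (cases "m = 0")
      case True
      then show ?thesis
        using PR by (simp add: a'_def)
    next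
      case False
      then have "a' = q ^ expo_B m j * word_factor (m - 1) j h"
        using IH(1)[of "m - 1" j h] by (simp add: a'_def expo_B_rec q_def)
      then have "D * a' = q ^ expo_B m j * (D * word_factor (m - 1) j h)"
        by simp
      also have "D * word_factor (m - 1) j h = (1 - q ^ (2 * m)) * K"
        using False word_factor_A[of m j h, where 'a = 'a]
        by (simp add: D_def Q_def N_def s_def q_def K_def)
      finally show ?thesis
        using PR by (simp add: R_def algebra_simps)
    qed
    have b': "D * b' = P - N * R"
    proof (cases "j = 0")
      case True
      then show ?thesis
        using PR by (simp add: b'_def)
    next
      case False
      then have "b' = q ^ expo_A m j * word_factor m (j - 1) h"
        using IH(2)[of m "j - 1" h] by (simp add: b'_def expo_A_rec q_def)
      then have "D * b' = q ^ expo_A m j * (D * word_factor m (j - 1) h)"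
        by simp
      also have "D * word_factor m (j - 1) h = (1 - q ^ (2 * j)) * K"
        using False word_factor_B[of j m h, where 'a = 'a]
        by (simp add: D_def Q_def N_def s_def q_def K_def)
      finally show ?thesis
        using PR by (simp add: P_def algebra_simps)
    qed
    have u': "(1 - Q) * u' = (1 - H) * (P - (1 - Q) * b')"
    proof (cases "h = 0")
      case True
      then show ?thesis
        by (simp add: u'_def H_def)
    next
      case False
      have 1: "(1 - Q) * word_sum A m j (h - 1) = (1 - H) * P"
      proof -
        have "word_sum A m j (h - 1) = q ^ expo_A m j * word_factor m j (h - 1)"
          using IH(1)[of m j "h - 1"] False by (simp add: q_def)
        moreover have "(1 - Q) * word_factor m j (h - 1) = (1 - H) * K"
          using False word_factor_U[of h m j, where 'a = 'a]
          by (simp add: Q_def H_def s_def q_def K_def)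
        ultimately show ?thesis
          by (simp add: P_def mult.left_commute)
      qed
      \<comment> \<open>One b fewer gives length s - 1, and restoring the u by
        \<open>word_factor_U\<close> yields the same factor 1 - H as in the preceding fact.\<close>
      have 2: "(1 - q ^ (s - 1)) * (fps_X * word_sum B m (j - 1) (h - 1)) = (1 - H) * b'" if "j \<noteq> 0"
      proof -
        have "word_sum B m (j - 1) (h - 1) = q ^ expo_B m (j - 1) * word_factor m (j - 1) (h - 1)"
          "word_sum B m (j - 1) h = q ^ expo_B m (j - 1) * word_factor m (j - 1) h"
          using IH(2)[of m "j - 1" "h - 1"] IH(2)[of m "j - 1" "h"] False that by (simp_all add: q_def)
        moreover have "(1 - q ^ (s - 1)) * word_factor m (j - 1) (h - 1) = (1 - H) * word_factor m (j - 1) h"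
          using False that word_factor_U[of h m "j - 1", where 'a = 'a]
          by (simp add: H_def s_def q_def)
        ultimately show ?thesis
          using that by (simp add: b'_def mult.left_commute)
      qed
      have "u' = word_sum A m j (h - 1) -
          (if j = 0 then 0 else (1 - q ^ (s - 1)) * (fps_X * word_sum B m (j - 1) (h - 1)))"
        using IH(3)[of m j "h - 1"] False by (simp add: u'_def s_def q_def)
      also have "\<dots> = word_sum A m j (h - 1) - (1 - H) * b'"
        using 2 by (simp add: b'_def)
      finally have u: "u' = word_sum A m j (h - 1) - (1 - H) * b'" .
      have "(1 - Q) * u' = (1 - Q) * word_sum A m j (h - 1) - (1 - H) * ((1 - Q) * b')"
        unfolding u by (simp add: algebra_simps)
      then show ?thesis
        unfolding 1 by (simp add: algebra_simps)
    qed
    have Du': "D * u' = (1 - H) * N * (P + R)"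
    proof -
      have "D * u' = (1 + N) * ((1 - Q) * u')"
        by (simp add: D_def)
      also have "\<dots> = (1 - H) * ((1 + N) * P - D * b')"
        unfolding u' by (simp add: D_def algebra_simps)
      finally show ?thesis
        unfolding b' by (simp add: algebra_simps)
    qed
    have rec: "word_sum x m j h = q ^ (s * step A x) * a' + q ^ (s * step B x) * b' + u'" for x
      using word_sum_rec[of m j h x, where 'a = 'a] False
      by (auto simp: a'_def b'_def u'_def s_def q_def)
    have "D $ 0 \<noteq> 0"
      using False by (auto simp: D_def Q_def N_def q_def s_def)
    then have "D \<noteq> 0"
      by auto
    \<comment> \<open>Before an a, the letter a has step 1 and b has step 0; before a b it is the
      other way round. Hence \<open>Q\<close> multiplies only one of the two summands.\<close>
    have "D * word_sum A m j h = Q * (D * a') + D * b' + D * u'"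
      using rec[of A] by (simp add: Q_def algebra_simps)
    also have "\<dots> = D * P"
      unfolding a' b' Du' by (simp add: D_def Q algebra_simps)
    finally have A: "word_sum A m j h = P"
      using \<open>D \<noteq> 0\<close> by simp
    have "D * word_sum B m j h = D * a' + Q * (D * b') + D * u'"
      using rec[of B] by (simp add: Q_def algebra_simps)
    also have "\<dots> = D * R"
      unfolding a' b' Du' by (simp add: D_def Q algebra_simps)
    finally have B: "word_sum B m j h = R"
      using \<open>D \<noteq> 0\<close> by simp
    have U: "word_sum U m j h = word_sum A m j h - (1 - Q) * b'"
      using rec[of A] rec[of U] by (simp add: Q_def algebra_simps)
    show "(word_sum A m j h :: 'a::field_char_0 fps) = fps_X ^ expo_A m j * word_factor m j h \<and>
      (word_sum B m j h :: 'a::field_char_0 fps) = fps_X ^ expo_B m j * word_factor m j h \<and>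
      (word_sum U m j h :: 'a::field_char_0 fps) = word_sum A m j h -
      (if j = 0 then 0 else (1 - fps_X ^ (m + j + h)) * (fps_X * word_sum B m (j - 1) h))"
      using A B U by (simp add: P_def R_def K_def Q_def b'_def q_def s_def)
  qed
qed

section \<open>Overlining and slack\<close>

text \<open>Lists start with the last part, so the forced overlines are those in positions beyond
  m.\<close>

definition admissible :: "nat \<Rightarrow> (bool \<times> nat) list \<Rightarrow> bool" where
  "admissible m r \<longleftrightarrow> (\<forall>p\<in>set (take (length r - m) r). fst p)"

text \<open>A drop at position p raises the parts in positions 1 to p, hence the factor p; the pair
  holds the overline and the slack beyond the least drop.\<close>

fun slack_exponent :: "(bool \<times> nat) list \<Rightarrow> nat" where
  "slack_exponent [] = 0"
| "slack_exponent ((ov, e) # r) = Suc (length r) * (of_bool ov + e) + slack_exponent r"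

definition slack_weight :: "'a::field fps \<Rightarrow> (bool \<times> nat) list \<Rightarrow> 'a fps" where
  "slack_weight d r = d ^ length (filter (\<lambda>p. \<not> fst p) r) * fps_X ^ slack_exponent r"

lemma admissible_Nil [simp]: "admissible m []"
  by (simp add: admissible_def)

lemma admissible_Cons: "admissible m (p # r) \<longleftrightarrow> (m \<le> length r \<longrightarrow> fst p) \<and> admissible m r"
  by (cases "m \<le> length r") (auto simp: admissible_def Suc_diff_le)

text \<open>At most m entries lack an overline, and every overlined one adds at least 1 to the
  exponent. This keeps the sum over encodings locally finite.\<close>

lemma admissible_length_le:
  assumes "admissible m r"
  shows "length r \<le> m + slack_exponent r"
proof -
  have "length (filter fst r) \<le> slack_exponent r"
    by (induction r rule: slack_exponent.induct) auto
  moreover have "length (filter fst (take (length r - m) r)) = length (take (length r - m) r)"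
    using assms by (simp add: admissible_def filter_id_conv)
  moreover have "length (filter fst (take (length r - m) r)) \<le> length (filter fst r)"
    by (metis append_take_drop_id filter_append le_add1 length_append)
  ultimately show ?thesis by simp
qed

lemma slack_le_slack_exponent: "p \<in> set r \<Longrightarrow> snd p \<le> slack_exponent r"
  by (induction r rule: slack_exponent.induct) auto

lemma has_sum_fps_geometric:
  fixes Q :: "'a::field fps"
  assumes "Q $ 0 = 0"
  shows "((\<lambda>e. Q ^ e) has_sum inverse (1 - Q)) UNIV"
proof (rule has_sum_fps_supersetI)
  fix n
  have "(1 - Q) $ 0 \<noteq> 0"
    using assms by simp
  then have "inverse (1 - Q) * (1 - Q) = 1"
    by (rule inverse_mult_eq_1)
  then have "(\<Sum>e<Suc n. Q ^ e) = inverse (1 - Q) * (1 - Q ^ Suc n)"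
    by (simp only: one_diff_power_eq mult.assoc[symmetric] mult_1_left)
  also have "\<dots> = inverse (1 - Q) - Q ^ Suc n * inverse (1 - Q)"
    by (simp add: algebra_simps)
  finally have "(\<Sum>e<Suc n. Q ^ e) $ n = inverse (1 - Q) $ n"
    using fps_power_mult_nth_eq_0[OF assms, of n "Suc n"] by simp
  moreover have "Q ^ e $ n = 0" if "e \<notin> {..<Suc n}" for e
    using fps_power_mult_nth_eq_0[OF assms, of n e 1] that by simp
  ultimately show "\<exists>Z. finite Z \<and> Z \<subseteq> UNIV \<and> (\<forall>e\<in>UNIV - Z. Q ^ e $ n = 0) \<and>
      inverse (1 - Q) $ n = (\<Sum>e\<in>Z. Q ^ e $ n)"
    by (intro exI[of _ "{..<Suc n}"]) (auto simp: fps_sum_nth)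
qed

text \<open>The positions are independent. Position p + 1 gives q^(p+1) if overlined, or d if not
  (only for p < m), times the geometric series of its slack.\<close>

lemma has_sum_slack_weight:
  "(slack_weight d has_sum
     (\<Prod>p<s. (fps_X ^ Suc p + (if p < m then d else 0)) * inverse (1 - fps_X ^ Suc p :: 'a::field fps)))
   {r. length r = s \<and> admissible m r}"
proof (induction s)
  case 0
  have "{r. length r = 0 \<and> admissible m r} = {[]}"
    by auto
  then show ?case
    by (intro has_sum_finiteI) (auto simp: slack_weight_def)
next
  case (Suc s)
  let ?Q = "fps_X ^ Suc s :: 'a fps"
  define V where "V = {ov. m \<le> s \<longrightarrow> ov}"
  have V: "V = (if m \<le> s then {True} else {True, False})"
    by (auto simp: V_def)
  have "((\<lambda>ov. if ov then ?Q else d) has_sum (?Q + (if s < m then d else 0))) V"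
    by (rule has_sum_finiteI) (auto simp: V)
  from has_sum_fps_times[OF this has_sum_fps_geometric[of ?Q]]
  have "((\<lambda>(ov, e). (if ov then ?Q else d) * ?Q ^ e) has_sum
      ((?Q + (if s < m then d else 0)) * inverse (1 - ?Q))) (V \<times> (UNIV :: nat set))"
    by simp
  from has_sum_fps_times[OF this Suc.IH]
  have "((\<lambda>((ov, e), r). ((if ov then ?Q else d) * ?Q ^ e) * slack_weight d r) has_sum
      (\<Prod>p<Suc s. (fps_X ^ Suc p + (if p < m then d else 0)) * inverse (1 - fps_X ^ Suc p)))
      ((V \<times> (UNIV :: nat set)) \<times> {r. length r = s \<and> admissible m r})"
    by (simp add: case_prod_unfold mult.commute)
  also have "?this \<longleftrightarrow> ?case"
  proof (rule has_sum_reindex_bij_witness[where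
        i = "\<lambda>r. (hd r, tl r)" and j = "\<lambda>(p, r). p # r"])
    fix a assume "a \<in> (V \<times> (UNIV :: nat set)) \<times> {r. length r = s \<and> admissible m r}"
    then obtain ov e r where a: "a = ((ov, e), r)" "ov \<in> V" "length r = s" "admissible m r"
      by auto
    then show "(case a of (p, r) \<Rightarrow> p # r) \<in> {r. length r = Suc s \<and> admissible m r}"
      by (auto simp: admissible_Cons V_def)
    show "slack_weight d (case a of (p, r) \<Rightarrow> p # r) =
        (\<lambda>((ov, e), r). ((if ov then ?Q else d) * ?Q ^ e) * slack_weight d r) a"
      using a by (simp add: slack_weight_def power_add power_mult[symmetric] algebra_simps)
  next
    fix r assume "r \<in> {r. length r = Suc s \<and> admissible m r}"
    then show "(case (hd r, tl r) of (p, r) \<Rightarrow> p # r) = r"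
      and "(hd r, tl r) \<in> (V \<times> (UNIV :: nat set)) \<times> {r. length r = s \<and> admissible m r}"
      by (cases r; auto simp: admissible_Cons V_def mem_Times_iff)+
  qed auto
  finally show ?case .
qed

section \<open>Encoding of jagged overpartitions\<close>

text \<open>Here \<open>x\<close> and \<open>l\<close> are the colour and the level of the part that follows the head; the list ends with a
  virtual part of colour \<open>a\<close> and level \<open>0\<close>.\<close>

fun decode :: "color \<Rightarrow> nat \<Rightarrow> color list \<Rightarrow> (bool \<times> nat) list \<Rightarrow> part list" where
  "decode x l (c # w) ((ov, e) # r) =
     Part (l + step c x + of_bool ov + e + of_bool (c = B)) c ov #
     decode c (l + step c x + of_bool ov + e) w r"
| "decode x l w r = []"

fun encode :: "color \<Rightarrow> nat \<Rightarrow> part list \<Rightarrow> (bool \<times> nat) list" where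
  "encode x l (Part v c ov # ps) =
     (ov, v - of_bool (c = B) - (l + step c x + of_bool ov)) # encode c (v - of_bool (c = B)) ps"
| "encode x l [] = []"

text \<open>The condition that no subtraction in \<open>encode\<close> truncates; it describes the
  range of \<open>decode\<close>.\<close>

fun rising :: "color \<Rightarrow> nat \<Rightarrow> part list \<Rightarrow> bool" where
  "rising x l (Part v c ov # ps) \<longleftrightarrow>
     l + step c x + of_bool ov + of_bool (c = B) \<le> v \<and> rising c (v - of_bool (c = B)) ps"
| "rising x l [] \<longleftrightarrow> True"

text \<open>Integer valued because the part 0_b has level -1.\<close>

definition level :: "part \<Rightarrow> int" where
  "level p = int (val p) - of_bool (col p = B)"

lemma rising_decode: "rising x l (decode x l w r)"
  by (induction x l w r rule: decode.induct) auto

lemma encode_decode: "length w = length r \<Longrightarrow> encode x l (decode x l w r) = r"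
  by (induction x l w r rule: decode.induct) auto

lemma decode_encode: "rising x l ps \<Longrightarrow> decode x l (map col ps) (encode x l ps) = ps"
  by (induction x l ps rule: rising.induct) auto

lemma length_encode [simp]: "length (encode x l ps) = length ps"
  by (induction x l ps rule: encode.induct) auto

lemma map_fst_encode: "map fst (encode x l ps) = map overlined ps"
  by (induction x l ps rule: encode.induct) auto

lemma map_col_decode: "length w = length r \<Longrightarrow> map col (decode x l w r) = w"
  by (induction x l w r rule: decode.induct) auto

lemma map_overlined_decode: "length w = length r \<Longrightarrow> map overlined (decode x l w r) = map fst r"
  by (induction x l w r rule: decode.induct) auto

text \<open>Each drop counts with its position, the initial level l counts once for every part, and
  each b adds one because its value exceeds its level.\<close>

lemma sum_val_decode:
  "length w = length r \<Longrightarrow>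
     sum_list (map val (decode x l w r)) = length w * l + word_weight w x + slack_exponent r"
  by (induction x l w r rule: decode.induct) (auto simp: algebra_simps)

section \<open>Difference conditions in terms of levels\<close>

definition gap_ok :: "part \<Rightarrow> part \<Rightarrow> bool" where
  "gap_ok y x \<longleftrightarrow> min_diff x y \<le> int (val x) - int (val y)"

text \<open>Shifting b by one turns the matrix into a step between colours plus 1 for an overline on
  the earlier part; the 36 pairs of types are checked one by one.\<close>

lemma gap_ok_iff_level: "gap_ok y x \<longleftrightarrow> level y + int (step (col x) (col y)) + of_bool (overlined x) \<le> level x"
proof (cases x; cases y)
  fix v c ov v' c' ov'
  assume "x = Part v c ov" "y = Part v' c' ov'"
  then show ?thesis
    by (cases c; cases c'; cases ov; cases ov')
       (auto simp: gap_ok_def min_diff_def diff_matrix_def level_def)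
qed

lemma rising_iff_successively:
  assumes "level p = int l" "col p = x"
  shows "rising x l ps \<longleftrightarrow> successively gap_ok (p # ps)"
  using assms
proof (induction ps arbitrary: p l x)
  case (Cons z ps)
  obtain v c ov where z: "z = Part v c ov"
    by (cases z)
  have gap: "gap_ok p z \<longleftrightarrow> l + step c x + of_bool ov + of_bool (c = B) \<le> v"
    using Cons.prems by (auto simp: gap_ok_iff_level z level_def)
  show ?case
  proof (cases "l + step c x + of_bool ov + of_bool (c = B) \<le> v")
    case True
    then have "level z = int (v - of_bool (c = B))"
      by (auto simp: level_def z)
    then show ?thesis
      using Cons.IH[of z "v - of_bool (c = B)" c] gap True by (simp add: z)
  next
    case False
    then show ?thesis
      using gap by (simp add: z)
  qed
qed simp

text \<open>Supplies the nonlocal conditions on overlines: levels never fall towards the front and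
  rise strictly at an overline, so overlined parts are positive and an overlined occurrence is the
  final one.\<close>

lemma rising_levels:
  assumes "rising x l ps"
  shows "(\<forall>p\<in>set ps. int l + of_bool (overlined p) \<le> level p) \<and>
    sorted_wrt (\<lambda>p p'. level p + of_bool (overlined p') \<le> level p') ps"
  using assms
proof (induction x l ps rule: rising.induct)
  case (1 x l v c ov ps)
  then have l: "int l + of_bool ov \<le> level (Part v c ov)" and v: "of_bool (c = B) \<le> v"
    by (auto simp: level_def)
  moreover have "level (Part v c ov) = int (v - of_bool (c = B))"
    using v by (auto simp: level_def)
  ultimately have IH: "\<forall>p\<in>set ps. level (Part v c ov) + of_bool (overlined p) \<le> level p"
      "sorted_wrt (\<lambda>p p'. level p + of_bool (overlined p') \<le> level p') ps"
    using 1 by auto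
  have "int l \<le> level (Part v c ov)"
    using l by (cases ov) auto
  then show ?case
    using l IH by fastforce
qed simp

lemma jagged_overpartition_iff_rising: "jagged_overpartition xs \<longleftrightarrow> rising A 0 (rev xs)"
proof -
  let ?z = "Part 0 A False"
  have rising: "rising A 0 (rev xs) \<longleftrightarrow> successively gap_ok (?z # rev xs)"
    by (rule rising_iff_successively) (auto simp: level_def)
  have succ: "successively gap_ok (?z # rev xs) \<longleftrightarrow>
      (xs \<noteq> [] \<longrightarrow> gap_ok ?z (last xs)) \<and>
      (\<forall>s. Suc s < length xs \<longrightarrow> gap_ok (xs ! Suc s) (xs ! s))"
    by (simp only: successively_Cons successively_rev) (auto simp: hd_rev successively_conv_nth)
  \<comment> \<open>The four excluded last parts are exactly those that fail the gap to the virtual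
    part 0_a.\<close>
  have last: "gap_ok ?z p \<longleftrightarrow> p \<notin> {Part 0 A False, Part 0 B False, Part 1 A True, Part 1 B True}"
    if "overlined p \<longrightarrow> val p > 0" for p
  proof (cases p)
    case (Part v c ov)
    then show ?thesis
      using that by (cases c; cases ov) (auto simp: gap_ok_iff_level level_def)
  qed
  have pos: "overlined p \<longrightarrow> val p > 0" if "rising A 0 (rev xs)" "p \<in> set xs" for p
  proof -
    have "of_bool (overlined p) \<le> level p"
      using rising_levels[OF that(1)] that(2) by auto
    then show ?thesis
      by (cases "col p = B") (auto simp: level_def)
  qed
  have final: "\<not> (val (xs ! t) = val (xs ! s) \<and> col (xs ! t) = col (xs ! s))"
    if "rising A 0 (rev xs)" "s < t" "t < length xs" "overlined (xs ! s)" for s t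
  proof -
    have "sorted_wrt (\<lambda>p' p. level p + of_bool (overlined p') \<le> level p') xs"
      using rising_levels[OF that(1)] by (simp add: sorted_wrt_rev)
    then have "level (xs ! t) < level (xs ! s)"
      using that by (fastforce dest: sorted_wrt_nth_less)
    then show ?thesis
      by (auto simp: level_def)
  qed
  show ?thesis
  proof
    assume j: "jagged_overpartition xs"
    then show "rising A 0 (rev xs)"
      unfolding rising succ using last
      by (auto simp: jagged_overpartition_def gap_ok_def)
  next
    assume r: "rising A 0 (rev xs)"
    then have s: "(xs \<noteq> [] \<longrightarrow> gap_ok ?z (last xs)) \<and>
        (\<forall>s. Suc s < length xs \<longrightarrow> gap_ok (xs ! Suc s) (xs ! s))"
      unfolding rising succ .
    have "last xs \<notin> {Part 0 A False, Part 0 B False, Part 1 A True, Part 1 B True}" if "xs \<noteq> []"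
      using last[of "last xs"] pos[OF r, of "last xs"] s that by simp
    then show "jagged_overpartition xs"
      unfolding jagged_overpartition_def using pos[OF r] final[OF r] s
      by (auto simp: gap_ok_def)
  qed
qed

lemma length_filter_not_A: "length (filter (\<lambda>x. col x = B \<or> col x = U) xs) = length xs - count_list (map col xs) A"
proof (induction xs)
  case (Cons p xs)
  have "count_list (map col xs) A \<le> length xs"
    by (metis count_le_length length_map)
  then show ?case
    using Cons by (cases "col p") (auto simp: Suc_diff_le)
qed simp

lemma length_filter_col: "length (filter (\<lambda>x. col x = c) xs) = count_list (map col xs) c"
  by (induction xs) auto

lemma final_parts_overlined_iff_admissible:
  "final_parts_overlined xs \<longleftrightarrow> admissible (count_list (map col xs) A) (encode x l (rev xs))"
proof -
  let ?m = "count_list (map col xs) A"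
  have "admissible ?m (encode x l (rev xs)) \<longleftrightarrow>
      (\<forall>b\<in>set (take (length xs - ?m) (map fst (encode x l (rev xs)))). b)"
    by (simp add: admissible_def take_map)
  also have "\<dots> \<longleftrightarrow> (\<forall>p\<in>set (take (length xs - ?m) (rev xs)). overlined p)"
    by (simp add: map_fst_encode take_map)
  also have "\<dots> \<longleftrightarrow> final_parts_overlined xs"
    by (simp add: final_parts_overlined_def length_filter_not_A take_rev Let_def)
  finally show ?thesis ..
qed

section \<open>The generating function\<close>

definition encodings :: "(color list \<times> (bool \<times> nat) list) set" where
  "encodings = {(w, r). length r = length w \<and> admissible (count_list w A) r}"

definition encoding_weight ::
  "'a::field fps \<Rightarrow> 'a fps \<Rightarrow> 'a fps \<Rightarrow> color list \<times> (bool \<times> nat) list \<Rightarrow> 'a fps" where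
  "encoding_weight a b d = (\<lambda>(w, r).
     (a ^ count_list w A * b ^ count_list w B * fps_X ^ word_weight w A) * slack_weight d r)"

text \<open>An a costs at least 1 unless a b follows, and then the extra one of that b pays for it;
  the correction covers a b following the head. This bounds m in the finiteness argument.\<close>

lemma count_A_le_word_weight: "count_list w A \<le> word_weight w x + of_bool (x = B)"
proof (induction w arbitrary: x)
  case (Cons c w)
  show ?case
    using Cons.IH[of c] by (cases c) auto
qed simp

text \<open>A bounded power of q bounds the slacks and the number of a, hence the length by
  \<open>admissible_length_le\<close>; only finitely many encodings reach a given
  coefficient.\<close>

lemma summable_encoding_weight: "encoding_weight a b d summable_on encodings"
proof (rule summable_on_fps)
  fix n
  let ?W = "{w. set w \<subseteq> (UNIV :: color set) \<and> length w \<le> 2 * n}"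
  let ?R = "{r. set r \<subseteq> (UNIV :: bool set) \<times> {..n} \<and> length r \<le> 2 * n}"
  have "finite (?W \<times> ?R)"
    by (intro finite_cartesian_product finite_lists_length_le) (auto simp: UNIV_color)
  moreover have "{x \<in> encodings. encoding_weight a b d x $ n \<noteq> 0} \<subseteq> ?W \<times> ?R"
  proof
    fix x assume "x \<in> {x \<in> encodings. encoding_weight a b d x $ n \<noteq> 0}"
    then obtain w r where x: "x = (w, r)" "length r = length w" "admissible (count_list w A) r"
        and nz: "encoding_weight a b d (w, r) $ n \<noteq> 0"
      by (auto simp: encodings_def)
    have "encoding_weight a b d (w, r) = fps_X ^ (word_weight w A + slack_exponent r) *
        (a ^ count_list w A * b ^ count_list w B * d ^ length (filter (\<lambda>p. \<not> fst p) r))"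
      by (simp add: encoding_weight_def slack_weight_def power_add ac_simps)
    with nz have le: "word_weight w A + slack_exponent r \<le> n"
      using fps_power_mult_nth_eq_0[of "fps_X :: 'a fps"] by (metis fps_X_nth not_le zero_neq_one)
    then have "length r \<le> 2 * n"
      using admissible_length_le[OF x(3)] count_A_le_word_weight[of w A] by simp
    moreover have "snd p \<le> n" if "p \<in> set r" for p
      using slack_le_slack_exponent[OF that] le by linarith
    ultimately show "x \<in> ?W \<times> ?R"
      using x by auto
  qed
  ultimately show "finite {x \<in> encodings. encoding_weight a b d x $ n \<noteq> 0}"
    by (rule rev_finite_subset)
qed

text \<open>The summand of the target series with d^m (-q/d; q)_m multiplied out, so that d is not
  inverted.\<close>

definition a_term :: "'a::field fps \<Rightarrow> 'a fps \<Rightarrow> nat \<Rightarrow> 'a fps" where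
  "a_term a d m = fps_X ^ (Suc m choose 2) * a ^ m * (\<Prod>p<m. d + fps_X ^ Suc p) *
     inverse (qpoch (fps_X\<^sup>2) (fps_X\<^sup>2) m)"

text \<open>Beyond position m the overlines are forced and contribute q^(m+1), ..., q^(m+l).\<close>

lemma prod_slack_numerator:
  "(\<Prod>p<m + l. fps_X ^ Suc p + (if p < m then d else 0)) =
     (\<Prod>p<m. d + fps_X ^ Suc p) * (fps_X :: 'a::field fps) ^ (m * l + (Suc l choose 2))"
proof (induction l)
  case 0
  show ?case
    by (simp add: add.commute numeral_2_eq_2)
next
  case (Suc l)
  have "m * Suc l + (Suc (Suc l) choose 2) = (m * l + (Suc l choose 2)) + Suc (m + l)"
    by (simp add: numeral_2_eq_2)
  then show ?case
    using Suc.IH by (simp add: power_add ac_simps)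
qed

lemma prod_slack_denominator:
  "(\<Prod>p<s. inverse (1 - fps_X ^ Suc p)) = inverse (qpoch fps_X fps_X s :: 'a::field fps)"
  by (induction s) (simp_all add: qpoch_Suc fps_inverse_mult)

lemma double_Suc_choose_two: "2 * int (Suc n choose 2) = int n * (int n + 1)"
  by (induction n) (simp_all add: numeral_2_eq_2 algebra_simps)

text \<open>This separates the variables: the mixed terms in m and j cancel, the part in j is
  doubled for base q^2, and (m + j) h supplies the argument q^(m+j) of Euler's sum over h.\<close>

lemma expo_A_total:
  "expo_A m j + (m * (j + h) + (Suc (j + h) choose 2)) =
     (Suc m choose 2) + 2 * (Suc j choose 2) + ((m + j) * h + (Suc h choose 2))"
proof -
  have "2 * int (expo_A m j + (m * (j + h) + (Suc (j + h) choose 2))) =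
      2 * int ((Suc m choose 2) + 2 * (Suc j choose 2) + ((m + j) * h + (Suc h choose 2)))"
    unfolding of_nat_add of_nat_mult distrib_left double_expo_A double_Suc_choose_two
      mult.left_commute[of 2 "int 2"]
    by (simp add: power2_eq_square algebra_simps)
  then show ?thesis
    by (metis mult_cancel_left of_nat_eq_iff zero_neq_numeral)
qed

text \<open>The slack denominators cancel (q; q)_(m+j+h) from \<open>word_factor\<close>, and
  \<open>expo_A_total\<close> distributes the powers of q.\<close>

lemma fibre_sum:
  fixes a b d :: "'a::field_char_0 fps"
  shows "(a ^ m * b ^ j * word_sum A m j h) *
      (\<Prod>p<m + j + h. (fps_X ^ Suc p + (if p < m then d else 0)) * inverse (1 - fps_X ^ Suc p)) =
    a_term a d m * euler_term (fps_X\<^sup>2) b j *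
      (qpoch (- fps_X) fps_X (m + j) * euler_term fps_X (fps_X ^ (m + j)) h)"
proof -
  let ?q = "qpoch fps_X fps_X (m + j + h) :: 'a fps"
  have q: "?q * inverse ?q = 1"
    by (rule inverse_mult_eq_1') (simp add: qpoch_fps_nth_0)
  have prod: "(\<Prod>p<m + j + h. (fps_X ^ Suc p + (if p < m then d else 0)) * inverse (1 - fps_X ^ Suc p)) =
      (\<Prod>p<m. d + fps_X ^ Suc p) * fps_X ^ (m * (j + h) + (Suc (j + h) choose 2)) * inverse ?q"
    unfolding prod.distrib prod_slack_denominator
    using prod_slack_numerator[where m = m and l = "j + h" and d = d] by (simp add: add.assoc)
  have expo: "fps_X ^ expo_A m j * fps_X ^ (m * (j + h) + (Suc (j + h) choose 2)) =
      fps_X ^ (Suc m choose 2) * (fps_X\<^sup>2) ^ (Suc j choose 2) *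
      ((fps_X ^ (m + j)) ^ h * (fps_X :: 'a fps) ^ (Suc h choose 2))"
    unfolding power_add[symmetric] power_mult[symmetric] expo_A_total ..
  let ?P = "\<Prod>p<m. d + fps_X ^ Suc p"
  let ?i = "\<lambda>n. inverse (qpoch (fps_X\<^sup>2) (fps_X\<^sup>2) n) :: 'a fps"
  have "(a ^ m * b ^ j * word_sum A m j h) *
      (\<Prod>p<m + j + h. (fps_X ^ Suc p + (if p < m then d else 0)) * inverse (1 - fps_X ^ Suc p)) =
    (?q * inverse ?q) * (fps_X ^ expo_A m j * fps_X ^ (m * (j + h) + (Suc (j + h) choose 2))) *
    (a ^ m * b ^ j * ?P * qpoch (- fps_X) fps_X (m + j) * ?i m * ?i j * inverse (qpoch fps_X fps_X h))"
    unfolding prod word_sum_closed(1) word_factor_def by (simp only: ac_simps)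
  also have "\<dots> = a_term a d m * euler_term (fps_X\<^sup>2) b j *
      (qpoch (- fps_X) fps_X (m + j) * euler_term fps_X (fps_X ^ (m + j)) h)"
    unfolding q expo a_term_def euler_term_def by (simp only: ac_simps mult_1_left)
  finally show ?thesis .
qed

lemma has_sum_a_term: "(a_term a d has_sum (\<Sum>r. a_term a d r)) UNIV"
proof -
  have "a_term a d summable_on UNIV"
  proof (rule summable_on_fps)
    fix n
    have "a_term a d r $ n = 0" if "n < r" for r
    proof -
      have "n < Suc r choose 2"
        using Suc_choose_two_ge[of r] that by linarith
      then show ?thesis
        unfolding a_term_def mult.assoc by (intro fps_power_mult_nth_eq_0) auto
    qed
    then have "{r \<in> UNIV. a_term a d r $ n \<noteq> 0} \<subseteq> {..n}"
      by (force simp: not_le[symmetric])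
    then show "finite {r \<in> UNIV. a_term a d r $ n \<noteq> 0}"
      using finite_subset by blast
  qed
  then have "(a_term a d has_sum infsum (a_term a d) UNIV) UNIV"
    by (rule has_sum_infsum)
  then show ?thesis
    using suminf_fps_eqI by metis
qed

text \<open>Splits (-q; q)_inf after n factors, so the sum over h no longer depends on m +
  j.\<close>

lemma qpoch_mult_euler_sum:
  "qpoch (- fps_X) fps_X n * euler_sum fps_X (fps_X ^ n) = (euler_sum fps_X 1 :: 'a::field fps)"
  using euler_sum_finite_prod[of "fps_X :: 'a fps" 1 n] by (simp add: qpoch_def)

lemma has_sum_encoding_weight:
  fixes a b d :: "'a::field_char_0 fps"
  shows "(encoding_weight a b d has_sum
    (euler_sum fps_X 1 * euler_sum (fps_X\<^sup>2) b * (\<Sum>r. a_term a d r))) encodings"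
proof -
  \<comment> \<open>Local finiteness gives existence; the value is then found by grouping by (m, j,
    h), summing over h, and factoring the rest.\<close>
  define S where "S = infsum (encoding_weight a b d) encodings"
  have S: "(encoding_weight a b d has_sum S) encodings"
    unfolding S_def by (rule has_sum_infsum) (rule summable_encoding_weight)
  define g where "g = (\<lambda>(m, j, h). a_term a d m * euler_term (fps_X\<^sup>2) b j *
      (qpoch (- fps_X) fps_X (m + j) * euler_term fps_X (fps_X ^ (m + j)) h))"
  have "(g has_sum S) UNIV"
  proof (rule has_sum_fps_fibres[OF S])
    let ?\<pi> = "\<lambda>(w, r :: (bool \<times> nat) list). (count_list w A, count_list w B, count_list w U)"
    show "?\<pi> ` encodings \<subseteq> UNIV"
      by simp
    fix i :: "nat \<times> nat \<times> nat"
    obtain m j h where i: "i = (m, j, h)"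
      by (cases i)
    have "((\<lambda>w. a ^ m * b ^ j * fps_X ^ word_weight w A) has_sum (a ^ m * b ^ j * word_sum A m j h))
        (words m j h)"
      by (rule has_sum_finiteI) (auto simp: finite_words word_sum_def sum_distrib_left)
    from has_sum_fps_times[OF this has_sum_slack_weight[of d "m + j + h" m]]
    have "((\<lambda>(w, r). (a ^ m * b ^ j * fps_X ^ word_weight w A) * slack_weight d r) has_sum g (m, j, h))
        (words m j h \<times> {r. length r = m + j + h \<and> admissible m r})"
      unfolding g_def split_conv fibre_sum .
    also have "words m j h \<times> {r. length r = m + j + h \<and> admissible m r} =
        {x \<in> encodings. ?\<pi> x = i}"
      by (auto simp: encodings_def i words_def length_eq_count_list_color)
    also have "((\<lambda>(w, r). (a ^ m * b ^ j * fps_X ^ word_weight w A) * slack_weight d r) has_sum g (m, j, h))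
        {x \<in> encodings. ?\<pi> x = i} \<longleftrightarrow> (encoding_weight a b d has_sum g i) {x \<in> encodings. ?\<pi> x = i}"
      unfolding i by (rule has_sum_cong) (auto simp: encoding_weight_def)
    finally show "(encoding_weight a b d has_sum g i) {x \<in> encodings. ?\<pi> x = i}" .
  qed
  then have "((\<lambda>(m, j). a_term a d m * euler_term (fps_X\<^sup>2) b j * euler_sum fps_X 1) has_sum S) UNIV"
  proof (rule has_sum_fps_fibres)
    let ?\<pi> = "\<lambda>(m, j, h :: nat). (m, j) :: nat \<times> nat"
    show "?\<pi> ` UNIV \<subseteq> UNIV"
      by simp
    fix i :: "nat \<times> nat"
    obtain m j where i: "i = (m, j)"
      by (cases i)
    have fibre: "{x \<in> UNIV. ?\<pi> x = i} = (\<lambda>h. (m, j, h)) ` UNIV"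
      by (auto simp: i)
    have "((\<lambda>h. a_term a d m * euler_term (fps_X\<^sup>2) b j * (qpoch (- fps_X) fps_X (m + j) *
          euler_term fps_X (fps_X ^ (m + j)) h)) has_sum
        (a_term a d m * euler_term (fps_X\<^sup>2) b j * euler_sum fps_X 1)) UNIV"
      unfolding qpoch_mult_euler_sum[of "m + j", symmetric]
      by (intro has_sum_fps_cmult has_sum_euler) simp
    then show "(g has_sum (case i of (m, j) \<Rightarrow> a_term a d m * euler_term (fps_X\<^sup>2) b j * euler_sum fps_X 1))
        {x \<in> UNIV. ?\<pi> x = i}"
      unfolding fibre by (subst has_sum_reindex) (auto simp: inj_on_def o_def g_def i)
  qed
  moreover have "((\<lambda>(m, j). a_term a d m * euler_term (fps_X\<^sup>2) b j * euler_sum fps_X 1) has_sum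
      (euler_sum fps_X 1 * euler_sum (fps_X\<^sup>2) b * (\<Sum>r. a_term a d r))) UNIV"
    using has_sum_fps_cmult[OF has_sum_fps_times[OF has_sum_a_term has_sum_euler], of "fps_X\<^sup>2" "euler_sum fps_X 1" a d b]
    by (simp add: case_prod_unfold ac_simps power2_eq_square)
  ultimately have "S = euler_sum fps_X 1 * euler_sum (fps_X\<^sup>2) b * (\<Sum>r. a_term a d r)"
    by (rule has_sum_fps_unique)
  then show ?thesis
    using S by simp
qed

section \<open>Transfer to jagged overpartitions\<close>

definition C2_partitions :: "part list set" where
  "C2_partitions = {xs. jagged_overpartition xs \<and> final_parts_overlined xs}"

definition part_weight :: "'a::field fps \<Rightarrow> 'a fps \<Rightarrow> 'a fps \<Rightarrow> part list \<Rightarrow> 'a fps" where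
  "part_weight a b d xs = a ^ length (filter (\<lambda>x. col x = A) xs) * b ^ length (filter (\<lambda>x. col x = B) xs) *
     d ^ length (filter (\<lambda>x. \<not> overlined x) xs) * fps_X ^ sum_list (map val xs)"

lemma count_list_rev: "count_list (rev xs) x = count_list xs x"
  by (induction xs) auto

text \<open>\<open>encode\<close> and \<open>decode\<close> are mutually inverse here;
  \<open>rev\<close> appears because encodings start with the last part.\<close>

lemma has_sum_part_weight:
  fixes a b d :: "'a::field_char_0 fps"
  shows "(part_weight a b d has_sum
    (euler_sum fps_X 1 * euler_sum (fps_X\<^sup>2) b * (\<Sum>r. a_term a d r))) C2_partitions"
proof -
  have "(encoding_weight a b d has_sum
      (euler_sum fps_X 1 * euler_sum (fps_X\<^sup>2) b * (\<Sum>r. a_term a d r))) encodings \<longleftrightarrow>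
    (part_weight a b d has_sum
      (euler_sum fps_X 1 * euler_sum (fps_X\<^sup>2) b * (\<Sum>r. a_term a d r))) C2_partitions"
  proof (rule has_sum_reindex_bij_witness[where
        i = "\<lambda>xs. (map col (rev xs), encode A 0 (rev xs))" and
        j = "\<lambda>(w, r). rev (decode A 0 w r)"])
    fix x assume "x \<in> encodings"
    then obtain w r where x: "x = (w, r)" "length w = length r" "admissible (count_list w A) r"
      by (auto simp: encodings_def)
    let ?xs = "rev (decode A 0 w r)"
    show "(map col (rev (case x of (w, r) \<Rightarrow> rev (decode A 0 w r))),
        encode A 0 (rev (case x of (w, r) \<Rightarrow> rev (decode A 0 w r)))) = x"
      using x by (simp add: map_col_decode encode_decode)
    have cols: "map col ?xs = rev w"
      using x by (simp add: rev_map[symmetric] map_col_decode)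
    have "jagged_overpartition ?xs"
      by (simp add: jagged_overpartition_iff_rising rising_decode)
    moreover have "final_parts_overlined ?xs"
      using x unfolding final_parts_overlined_iff_admissible[of _ A 0] cols
      by (simp add: encode_decode count_list_rev)
    ultimately show "(case x of (w, r) \<Rightarrow> rev (decode A 0 w r)) \<in> C2_partitions"
      using x by (simp add: C2_partitions_def)
    have "length (filter (\<lambda>x. \<not> overlined x) ?xs) = length (filter (\<lambda>p. \<not> fst p) r)"
    proof -
      have "length (filter (\<lambda>x. \<not> overlined x) ?xs) = length (filter Not (map overlined ?xs))"
        by (simp add: filter_map o_def)
      also have "map overlined ?xs = rev (map fst r)"
        using x by (simp only: rev_map[symmetric] map_overlined_decode)
      also have "length (filter Not (rev (map fst r))) = length (filter (\<lambda>p. \<not> fst p) r)"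
        by (simp add: rev_filter[symmetric] filter_map o_def)
      finally show ?thesis .
    qed
    moreover have "sum_list (map val ?xs) = word_weight w A + slack_exponent r"
      using sum_val_decode[of w r A 0] x by (simp add: rev_map[symmetric] sum_list_rev)
    ultimately show "part_weight a b d (case x of (w, r) \<Rightarrow> rev (decode A 0 w r)) = encoding_weight a b d x"
      unfolding x(1) part_weight_def length_filter_col prod.case cols
      by (simp add: encoding_weight_def slack_weight_def count_list_rev power_add ac_simps)
  next
    fix xs assume "xs \<in> C2_partitions"
    then have xs: "rising A 0 (rev xs)" "final_parts_overlined xs"
      by (simp_all add: C2_partitions_def jagged_overpartition_iff_rising)
    show "(case (map col (rev xs), encode A 0 (rev xs)) of (w, r) \<Rightarrow> rev (decode A 0 w r)) = xs"
      using xs(1) by (simp add: decode_encode)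
    show "(map col (rev xs), encode A 0 (rev xs)) \<in> encodings"
      using xs(2) unfolding final_parts_overlined_iff_admissible[of _ A 0]
      by (simp add: encodings_def rev_map[symmetric] count_list_rev)
  qed simp
  then show ?thesis
    using has_sum_encoding_weight by blast
qed

lemma has_sum_C2:
  fixes a b d :: "'a::field_char_0 fps"
  shows "((\<lambda>(n, k, i, j). of_nat (C2 n k i j) * a ^ i * b ^ j * d ^ k * fps_X ^ n) has_sum
    (euler_sum fps_X 1 * euler_sum (fps_X\<^sup>2) b * (\<Sum>r. a_term a d r))) UNIV"
proof (rule has_sum_fps_fibres[OF has_sum_part_weight])
  let ?\<pi> = "\<lambda>xs. (sum_list (map val xs), length (filter (\<lambda>x. \<not> overlined x) xs),
      length (filter (\<lambda>x. col x = A) xs), length (filter (\<lambda>x. col x = B) xs))"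
  show "?\<pi> ` C2_partitions \<subseteq> UNIV"
    by simp
  fix t :: "nat \<times> nat \<times> nat \<times> nat"
  obtain n k i j where t: "t = (n, k, i, j)"
    by (cases t)
  have "{xs \<in> C2_partitions. ?\<pi> xs = t} = C2_set n k i j"
    by (auto simp: C2_partitions_def C2_set_def t)
  moreover have "(part_weight a b d has_sum of_nat (C2 n k i j) * a ^ i * b ^ j * d ^ k * fps_X ^ n)
      (C2_set n k i j)"
  proof (rule has_sum_finiteI[OF finite_C2_set])
    have "sum (part_weight a b d) (C2_set n k i j) =
        (\<Sum>xs\<in>C2_set n k i j. a ^ i * b ^ j * d ^ k * fps_X ^ n)"
      by (rule sum.cong) (auto simp: C2_set_def part_weight_def)
    then show "of_nat (C2 n k i j) * a ^ i * b ^ j * d ^ k * fps_X ^ n =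
        sum (part_weight a b d) (C2_set n k i j)"
      by (simp add: C2_def mult.assoc)
  qed
  ultimately show "(part_weight a b d has_sum
      (case t of (n, k, i, j) \<Rightarrow> of_nat (C2 n k i j) * a ^ i * b ^ j * d ^ k * fps_X ^ n))
      {xs \<in> C2_partitions. ?\<pi> xs = t}"
    by (simp add: t)
qed

section \<open>Specialisation to the indeterminates\<close>

lemma a_term_eq:
  "a_term var_a var_d r = var_q ^ ((r + 1) choose 2) * (var_a * var_d) ^ r *
     qpoch (- var_q / var_d) var_q r / qpoch (var_q ^ 2) (var_q ^ 2) r"
proof -
  have d: "var_d $ 0 \<noteq> 0"
    by (simp add: var_d_def)
  \<comment> \<open>One d goes into each factor of the Pochhammer symbol: d (1 + q^(p+1)/d) = d +
    q^(p+1).\<close>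
  have "var_d ^ r * qpoch (- var_q / var_d) var_q r = (\<Prod>p<r. var_d + var_q ^ Suc p)"
  proof (induction r)
    case (Suc r)
    have "var_d * (- var_q / var_d) = - var_q"
      using inverse_mult_eq_1'[OF d] by (simp add: fps_divide_unit[OF d] mult.left_commute)
    then have "var_d * (1 - (- var_q / var_d) * var_q ^ r) = var_d + var_q ^ Suc r"
      by (simp add: right_diff_distrib mult.assoc[symmetric])
    moreover have "var_d ^ Suc r * qpoch (- var_q / var_d) var_q (Suc r) =
        (var_d ^ r * qpoch (- var_q / var_d) var_q r) * (var_d * (1 - (- var_q / var_d) * var_q ^ r))"
      by (simp only: qpoch_Suc power_Suc ac_simps)
    ultimately show ?case
      unfolding Suc.IH by simp
  qed simp
  moreover have "qpoch (var_q ^ 2) (var_q ^ 2) r $ 0 \<noteq> 0"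
    by (simp add: qpoch_fps_nth_0 var_q_def fps_power_zeroth)
  ultimately show ?thesis
    by (simp add: a_term_def fps_divide_unit power_mult_distrib var_q_def ac_simps)
qed

theorem theorem1p6:
  shows "((\<lambda>(n, k, i, j).
            of_nat (C2 n k i j) * var_a ^ i * var_b ^ j * var_d ^ k * var_q ^ n)
          has_sum
          (qpoch_inf (- var_q) var_q * qpoch_inf (- var_b * var_q ^ 2) (var_q ^ 2) *
            (\<Sum>r. var_q ^ ((r + 1) choose 2) * (var_a * var_d) ^ r *
                  qpoch (- var_q / var_d) var_q r / qpoch (var_q ^ 2) (var_q ^ 2) r)))
         (UNIV :: (nat \<times> nat \<times> nat \<times> nat) set)"
proof -
  \<comment> \<open>Euler's product with z = 1 in base q, then with z = b in base q^2.\<close>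
  have "euler_sum fps_X 1 = qpoch_inf (- var_q) var_q"
    using euler_sum_eq_qpoch_inf[of "fps_X :: series" 1] by (simp add: var_q_def)
  moreover have "euler_sum (fps_X\<^sup>2) var_b = qpoch_inf (- var_b * var_q ^ 2) (var_q ^ 2)"
    using euler_sum_eq_qpoch_inf[of "fps_X\<^sup>2 :: series" var_b] by (simp add: var_q_def fps_power_zeroth)
  ultimately show ?thesis
    using has_sum_C2[of var_a var_b var_d] by (simp only: a_term_eq var_q_def)
qed

end
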